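(* Let $q$ be an indeterminate and let $n,m$ be positive integers. (a) Let $A_n(x,q)=\left(q^{\binom{i-j}{2}}\begin{bmatrix}i+j+x\\ i-j+1\end{bmatrix}\right)_{i,j=0}^{n-1}$ and suppose $n+1\le m\le 2n-1$. Let $v_{n,m}$ be the column vector with entries, for $0\le j\le n-1$, $$q^{\frac{(\lfloor m/2\rfloor-j)(\lfloor m/2\rfloor+5-3j)}{2}}\frac{[m]}{[m-j]}\begin{bmatrix}m-j\\ j\end{bmatrix}\ \text{ if $m$ is even},\qquad q^{\frac{(\lfloor m/2\rfloor-j)(\lfloor m/2\rfloor+7-3j)}{2}}\frac{[m]}{[m-j]}\begin{bmatrix}m-j\\ j\end{bmatrix}\ \text{ if $m$ is odd}.$$ Then $A_n(-m,q)\,v_{n,m}=0$. (b) Let $B_n(x,q)=\left(q^{\binom{i-j}{2}}\frac{[2i+x+1]}{[i+j+x]}\begin{bmatrix}i+j+x\\ i-j+1\end{bmatrix}\right)_{i,j=0}^{n-1}$ and suppose $n\le m\le 2n-1$. Let $u_{n,m}$ be the column vector with entries, for $0\le j\le n-1$, $$q^{\frac{(\lfloor m/2\rfloor-j)(\lfloor m/2\rfloor+3-3j)}{2}}\begin{bmatrix}m-j\\ j\end{bmatrix}\ \text{ if $m$ is even},\qquad q^{\frac{(\lfloor m/2\rfloor-j)(\lfloor m/2\rfloor+5-3j)}{2}}\begin{bmatrix}m-j\\ j\end{bmatrix}\ \text{ if $m$ is odd}.$$ Then $B_n(-m,q)\,u_{n,m}=0$.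
   Context: For any integer $a$, $[a]=\frac{1-q^a}{1-q}$ and $\binom{a}{2}=a(a-1)/2$. For any integer $y$ (possibly negative) and integer $r$, $\begin{bmatrix}y\\ r\end{bmatrix}=\prod_{l=1}^{r}\frac{1-q^{y-r+l}}{1-q^{l}}$ if $r\ge0$ and $0$ if $r<0$. In $B_n(x,q)$ the factor $\frac{[2i+x+1]}{[i+j+x]}\begin{bmatrix}i+j+x\\ i-j+1\end{bmatrix}$ is understood as the polynomial in $q^x$ it simplifies to, i.e. it equals $\frac{[2i+x+1]}{[i-j+1]}\begin{bmatrix}i+j+x-1\\ i-j\end{bmatrix}$ for $i\ge j$, equals $1$ for $j=i+1$, and $0$ for $j>i+1$; $B_n(-m,q)$ is obtained by substituting $x=-m$ in this form. *)

theory Defs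
  imports
    "Jordan_Normal_Form.Matrix"
    "HOL-Computational_Algebra.Polynomial"
    "HOL-Computational_Algebra.Fraction_Field"
begin

definition q_indet :: "'k::field poly fract" where
  "q_indet = Fract [:0, 1:] 1"

definition q_bracket :: "'a::field \<Rightarrow> int \<Rightarrow> 'a" where
  "q_bracket q a = (1 - q powi a) / (1 - q)"

definition choose2 :: "int \<Rightarrow> int" where
  "choose2 a = a * (a - 1) div 2"

definition q_binomial :: "'a::field \<Rightarrow> int \<Rightarrow> int \<Rightarrow> 'a" where
  "q_binomial q y r =
     (if r < 0 then 0 else \<Prod>l\<in>{1..r}. (1 - q powi (y - r + l)) / (1 - q powi l))"

definition A_mat :: "nat \<Rightarrow> int \<Rightarrow> 'a::field \<Rightarrow> 'a mat" where
  "A_mat n x q = mat n n (\<lambda>(i, j). let i = int i; j = int j in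
     q powi choose2 (i - j) * q_binomial q (i + j + x) (i - j + 1))"

(* The value at the integer x of [2i+x+1] / [i+j+x] * [i+j+x, i-j+1], read as the polynomial
   in q^x to which it simplifies; this makes sense also when i + j + x = 0, where the
   unsimplified quotient has a zero denominator. See B_factor_eq_quotient. *)
definition B_factor :: "int \<Rightarrow> int \<Rightarrow> int \<Rightarrow> 'a::field \<Rightarrow> 'a" where
  "B_factor i j x q =
     (if j \<le> i then q_bracket q (2 * i + x + 1) / q_bracket q (i - j + 1) *
                       q_binomial q (i + j + x - 1) (i - j)
      else if j = i + 1 then 1
      else 0)"

definition B_mat :: "nat \<Rightarrow> int \<Rightarrow> 'a::field \<Rightarrow> 'a mat" where
  "B_mat n x q = mat n n (\<lambda>(i, j). let i = int i; j = int j in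
     q powi choose2 (i - j) * B_factor i j x q)"

(* The divisions by 2 in the exponents below and in choose2 are exact: see even_exponent
   (with c = 3, 5, 7) and choose2_exact. The exponents may be negative. *)
definition v_vec :: "nat \<Rightarrow> nat \<Rightarrow> 'a::field \<Rightarrow> 'a vec" where
  "v_vec n m q = vec n (\<lambda>j. let j = int j; k = int (m div 2); c = (if even m then 5 else 7) in
     q powi ((k - j) * (k + c - 3 * j) div 2) *
     (q_bracket q (int m) / q_bracket q (int m - j)) * q_binomial q (int m - j) j)"

definition u_vec :: "nat \<Rightarrow> nat \<Rightarrow> 'a::field \<Rightarrow> 'a vec" where
  "u_vec n m q = vec n (\<lambda>j. let j = int j; k = int (m div 2); c = (if even m then 3 else 5) in
     q powi ((k - j) * (k + c - 3 * j) div 2) * q_binomial q (int m - j) j)"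

lemma choose2_exact: "2 * choose2 a = a * (a - 1)"
  by (simp add: choose2_def)

lemma even_exponent: "odd c \<Longrightarrow> even ((k - j) * (k + c - 3 * j))" for k j c :: int
  by auto

lemma B_factor_eq_quotient:
  fixes q :: "'a::field"
  assumes "q_bracket q (i + j + x) \<noteq> 0"
  shows "B_factor i j x q =
    q_bracket q (2 * i + x + 1) / q_bracket q (i + j + x) * q_binomial q (i + j + x) (i - j + 1)"
proof (cases "j \<le> i")
  case True
  define y r where "y = i + j + x" and "r = i - j + 1"
  have q1: "1 - q \<noteq> 0" using assms by (auto simp: q_bracket_def)
  have "{1..r} = insert r {1..r - 1}" using True by (auto simp: r_def)
  moreover have "y - 1 - (r - 1) = y - r" and "r \<ge> 1" using True by (simp_all add: r_def)
  ultimately have "q_binomial q y r = (1 - q powi y) / (1 - q powi r) * q_binomial q (y - 1) (r - 1)"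
    unfolding q_binomial_def by simp
  also have "(1 - q powi y) / (1 - q powi r) = q_bracket q y / q_bracket q r"
    using q1 by (simp add: q_bracket_def)
  finally show ?thesis
    using True assms by (simp add: B_factor_def y_def r_def)
next
  case False
  then show ?thesis
    using assms by (auto simp: B_factor_def q_binomial_def ac_simps)
qed

end

theory Submission
  imports Defs
begin

text \<open>
  After reflecting the factors with \<^term>\<open>1 - q powi (-a) = - (q powi (-a)) * (1 - q powi a)\<close>, the
  \<open>j\<close>-th summand of row \<open>i\<close> of either product is, up to a factor that does not depend on \<open>j\<close>,
  \<open>(-1)^j q^(j choose 2) [t, j] P(q^(-j))\<close> with \<open>t = i + 1\<close> and a polynomial \<open>P\<close> of degree \<open>i < t\<close>.
  The sum over \<open>j \<le> t\<close> vanishes because the \<open>q\<close>-binomial theorem gives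
  \<open>(\<Sum>j\<le>t. (-1)^j q^(j choose 2) [t, j] x^j) = (1 - x) (1 - x q) \<dots> (1 - x q^(t - 1))\<close>,
  which is \<open>0\<close> for \<open>x = q^(-s)\<close>, \<open>s < t\<close>.
\<close>

section \<open>Shifted \<open>q\<close>-Pochhammer products (q^(a+1); q)_r, with \<open>a\<close>
  any integer\<close>

definition q_prod :: "'a::field \<Rightarrow> int \<Rightarrow> nat \<Rightarrow> 'a" where
  "q_prod q a r = (\<Prod>l<r. 1 - q powi (a + int l + 1))"

lemma q_prod_0 [simp]: "q_prod q a 0 = 1"
  by (simp add: q_prod_def)

lemma q_prod_Suc: "q_prod q a (Suc r) = q_prod q a r * (1 - q powi (a + int r + 1))"
  by (simp add: q_prod_def)

lemma q_prod_Suc_left: "q_prod q a (Suc r) = (1 - q powi (a + 1)) * q_prod q (a + 1) r"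
  unfolding q_prod_def by (subst prod.lessThan_Suc_shift) (simp add: ac_simps)

lemma q_prod_add: "q_prod q a (r + s) = q_prod q a r * q_prod q (a + int r) s"
  by (induction s) (simp_all add: q_prod_Suc ac_simps)

text \<open>The exponents a + 1, ..., a + r are consecutive and run through 0, so one factor is 1 -
  q^0.\<close>

lemma q_prod_eq_0:
  assumes "a < 0" "0 \<le> a + int r"
  shows "q_prod q a r = 0"
proof -
  have "nat (- a - 1) < r" "a + int (nat (- a - 1)) + 1 = 0"
    using assms by auto
  then show ?thesis
    unfolding q_prod_def by (intro prod_zero) (auto intro!: bexI[of _ "nat (- a - 1)"])
qed

lemma q_binomial_eq_q_prod:
  "q_binomial q y (int r) = q_prod q (y - int r) r / q_prod q 0 r"
proof -
  have "q_binomial q y (int r) =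
      (\<Prod>l<r. (1 - q powi (y - int r + int (Suc l))) / (1 - q powi int (Suc l)))"
    unfolding q_binomial_def
    by (simp, rule prod.reindex_bij_witness[of _ "\<lambda>l. int (Suc l)" "\<lambda>l. nat (l - 1)"]) auto
  also have "\<dots> = q_prod q (y - int r) r / q_prod q 0 r"
    unfolding q_prod_def prod_dividef by (simp add: ac_simps)
  finally show ?thesis .
qed

section \<open>Bookkeeping of the exponents of \<open>q\<close>\<close>

lemma choose2_0 [simp]: "choose2 0 = 0"
  by (simp add: choose2_def)

lemma choose2_Suc: "choose2 (int (Suc j)) = choose2 (int j) + int j"
  using choose2_exact[of "int (Suc j)"] choose2_exact[of "int j"]
  by (simp add: algebra_simps)

text \<open>The summand \<open>2 * int (m mod 2)\<close> absorbs the case split on the parity of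
  \<open>m\<close>: c = 5 covers \<open>v_vec\<close> and c = 3 covers \<open>u_vec\<close>.\<close>

definition v_exponent :: "int \<Rightarrow> nat \<Rightarrow> nat \<Rightarrow> int" where
  "v_exponent c m j =
    (int (m div 2) - int j) * (int (m div 2) + (c + 2 * int (m mod 2)) - 3 * int j) div 2"

text \<open>The two factors have an odd sum, so one of them is even and the division is
  exact.\<close>

lemma double_v_exponent:
  assumes "odd c"
  shows "2 * v_exponent c m j =
    (int (m div 2) - int j) * (int (m div 2) + (c + 2 * int (m mod 2)) - 3 * int j)"
  unfolding v_exponent_def using assms by (intro dvd_mult_div_cancel) auto

text \<open>The choice of exponents in \<open>v_vec\<close> pays off here. Added to the exponent of
  the matrix entry and the one produced by reflection, they leave only
  \<open>choose2 (int j)\<close>, the power occurring in the \<open>q\<close>-binomial theorem, and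
  a part constant in \<open>j\<close>. After doubling, this is a polynomial identity.\<close>

lemma A_exponent:
  "choose2 (int i - int j) + (choose2 (int i + 1 - int j) - (int i + 1 - int j) * (int m - 2 * int j))
      + v_exponent 5 m j =
    choose2 (int j) + (choose2 (int i) + choose2 (int i + 1) - (int i + 1) * int m + v_exponent 5 m 0)"
proof -
  have "int m = 2 * int (m div 2) + int (m mod 2)"
    by (metis mult_div_mod_eq of_nat_add of_nat_mult of_nat_numeral)
  then show ?thesis
    using double_v_exponent[of 5 m j] double_v_exponent[of 5 m 0]
      choose2_exact[of "int i - int j"] choose2_exact[of "int i + 1 - int j"]
      choose2_exact[of "int j"] choose2_exact[of "int i"] choose2_exact[of "int i + 1"]
    by (simp add: algebra_simps)
qed

text \<open>The analogue for \<open>u_vec\<close>, where the product to be reflected has i - j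
  factors instead of i + 1 - j. It also covers i - j = -1.\<close>

lemma B_exponent:
  "choose2 (int i - int j) + (choose2 (int i - int j) - (int i - int j) * (int m - 2 * int j))
      + v_exponent 3 m j =
    choose2 (int j) + (2 * choose2 (int i) - int i * int m + v_exponent 3 m 0)"
proof -
  have "int m = 2 * int (m div 2) + int (m mod 2)"
    by (metis mult_div_mod_eq of_nat_add of_nat_mult of_nat_numeral)
  then show ?thesis
    using double_v_exponent[of 3 m j] double_v_exponent[of 3 m 0]
      choose2_exact[of "int i - int j"] choose2_exact[of "int j"] choose2_exact[of "int i"]
    by (simp add: algebra_simps)
qed

section \<open>Vector entries and row sums\<close>

lemma v_vec_index:
  "j < n \<Longrightarrow> v_vec n m q $ j = q powi v_exponent 5 m j *
    (q_bracket q (int m) / q_bracket q (int m - int j)) * q_binomial q (int m - int j) (int j)"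
  by (cases "even m") (simp_all add: v_vec_def v_exponent_def Let_def even_iff_mod_2_eq_zero)

lemma u_vec_index:
  "j < n \<Longrightarrow> u_vec n m q $ j = q powi v_exponent 3 m j * q_binomial q (int m - int j) (int j)"
  by (cases "even m") (simp_all add: u_vec_def v_exponent_def Let_def even_iff_mod_2_eq_zero)

text \<open>Since 0 <= m - n < n, the numerator contains 1 - q^0. Thus the entry formula of either
  vector gives 0 at index \<open>n\<close>, one past the end.\<close>

lemma q_binomial_last_eq_0:
  assumes "n \<le> m" "m \<le> 2 * n - 1" "n > 0"
  shows "q_binomial q (int m - int n) (int n) = 0"
  using assms q_prod_eq_0[of "int m - 2 * int n" n q] by (simp add: q_binomial_eq_q_prod)

text \<open>Row \<open>i\<close> reaches up to column \<open>Suc i\<close>, which for the last row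
  lies just outside the matrix. Adding the vanishing term \<open>g i n\<close> lets all rows be
  summed over the same range j <= i + 1.\<close>

lemma mult_mat_vec_eq_0I:
  fixes A :: "'a::semiring_0 mat"
  assumes A: "A \<in> carrier_mat n n" and v: "v \<in> carrier_vec n"
    and entries: "\<And>i j. i < n \<Longrightarrow> j < n \<Longrightarrow> A $$ (i, j) * v $ j = g i j"
    and zero: "\<And>i j. Suc i < j \<Longrightarrow> g i j = 0" "\<And>i. i < n \<Longrightarrow> g i n = 0"
    and sum: "\<And>i. i < n \<Longrightarrow> (\<Sum>j\<le>Suc i. g i j) = 0"
  shows "A *\<^sub>v v = 0\<^sub>v n"
proof (rule eq_vecI)
  fix i assume "i < dim_vec (0\<^sub>v n :: 'a vec)"
  then have i: "i < n" by simp
  have "(A *\<^sub>v v) $ i = (\<Sum>j\<in>{0..<n}. g i j)"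
    using A v i by (simp add: scalar_prod_def entries)
  also have "\<dots> = (\<Sum>j\<le>n. g i j)"
    using zero(2)[OF i] by (intro sum.mono_neutral_left) (auto simp: le_less)
  also have "\<dots> = (\<Sum>j\<le>Suc i. g i j)"
    using zero(1) i by (intro sum.mono_neutral_right) auto
  finally show "(A *\<^sub>v v) $ i = 0\<^sub>v n $ i"
    using sum i by simp
qed (use A in auto)

section \<open>Reflection and the finite \<open>q\<close>-binomial theorem\<close>

locale non_root_of_unity =
  fixes q :: "'a::field"
  assumes q_nonzero: "q \<noteq> 0"
    and power_neq_1: "n > 0 \<Longrightarrow> q ^ n \<noteq> 1"
begin

lemma powi_add: "q powi (a + b) = q powi a * q powi b"
  by (simp add: power_int_add q_nonzero)

lemma powi_neq_1: "a \<noteq> 0 \<Longrightarrow> q powi a \<noteq> 1"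
  using power_neq_1[of "nat \<bar>a\<bar>"] by (auto simp: power_int_def field_simps)

lemma one_neq_q [simp]: "1 \<noteq> q" "q \<noteq> 1"
  using power_neq_1[of 1] by auto

lemma q_prod_0_nonzero [simp]: "q_prod q 0 r \<noteq> 0"
  using powi_neq_1 by (force simp: q_prod_def)

text \<open>The factors on the left have exponents -c, ..., r - 1 - c, whose sum is the extracted
  power of \<open>q\<close>. Reflected and read backwards, they have exponents c - r + 1, ...,
  c.\<close>

lemma q_prod_reflect:
  "q_prod q (- c - 1) r =
    (-1) ^ r * q powi (choose2 (int r) - int r * c) * q_prod q (c - int r) r"
proof (induction r)
  case (Suc r)
  have "1 - q powi (int r - c) = - (q powi (int r - c)) * (1 - q powi (c - int r))"
    using q_nonzero by (simp add: algebra_simps flip: power_int_add)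
  moreover have "q powi (choose2 (int (Suc r)) - int (Suc r) * c) =
      q powi (choose2 (int r) - int r * c) * q powi (int r - c)"
    unfolding powi_add[symmetric] choose2_Suc by (simp add: algebra_simps)
  moreover have "q_prod q (c - int (Suc r)) (Suc r) =
      (1 - q powi (c - int r)) * q_prod q (c - int r) r"
    by (simp add: q_prod_Suc_left)
  ultimately show ?case
    by (simp add: q_prod_Suc Suc.IH)
qed simp

text \<open>For j <= t this is the coefficient (-1)^j q^(j choose 2) [t, j] of the
  \<open>q\<close>-binomial theorem divided by \<open>q_prod q 0 t\<close>, a constant that does not
  affect vanishing.\<close>

definition weight :: "nat \<Rightarrow> nat \<Rightarrow> 'a" where
  "weight t j = (-1) ^ j * q powi choose2 (int j) / (q_prod q 0 j * q_prod q 0 (t - j))"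

text \<open>The inductive step of the \<open>q\<close>-binomial theorem, by the Pascal-type
  splitting 1 - q^(t+1) = (1 - q^(t+1-j)) + q^(t+1-j) (1 - q^j). Each part cancels the last factor
  of one of the two products in the denominator of \<open>weight\<close>.\<close>

lemma sum_weight_Suc:
  "(1 - q ^ Suc t) * (\<Sum>j\<le>Suc t. weight (Suc t) j * x ^ j) =
    (1 - x * q ^ t) * (\<Sum>j\<le>t. weight t j * x ^ j)"
proof -
  define A where "A j = (1 - q ^ (Suc t - j)) * (weight (Suc t) j * x ^ j)" for j
  define B where "B j = q ^ (Suc t - j) * (1 - q ^ j) * (weight (Suc t) j * x ^ j)" for j
  have "(1 - q ^ Suc t) * (weight (Suc t) j * x ^ j) = A j + B j" if "j \<le> Suc t" for j
  proof -
    have "q ^ Suc t = q ^ (Suc t - j) * q ^ j"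
      using that by (simp only: flip: power_add) simp
    then show ?thesis
      by (simp add: A_def B_def algebra_simps)
  qed
  then have "(1 - q ^ Suc t) * (\<Sum>j\<le>Suc t. weight (Suc t) j * x ^ j) =
      (\<Sum>j\<le>Suc t. A j) + (\<Sum>j\<le>Suc t. B j)"
    unfolding sum_distrib_left sum.distrib[symmetric] by (intro sum.cong) auto
  \<comment> \<open>The term j = t + 1 drops out because its factor is 1 - q^0.\<close>
  also have "(\<Sum>j\<le>Suc t. A j) = (\<Sum>j\<le>t. weight t j * x ^ j)"
  proof -
    have "A j = weight t j * x ^ j" if "j \<le> t" for j
    proof -
      have "q_prod q 0 (Suc t - j) = q_prod q 0 (t - j) * (1 - q ^ (Suc t - j))"
        using that by (simp add: Suc_diff_le q_prod_Suc powi_add del: of_nat_diff)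
      moreover have "1 - q ^ (Suc t - j) \<noteq> 0"
        using power_neq_1[of "Suc t - j"] that by simp
      ultimately show ?thesis
        by (simp add: A_def weight_def)
    qed
    then have "(\<Sum>j\<le>t. A j) = (\<Sum>j\<le>t. weight t j * x ^ j)"
      by (intro sum.cong) auto
    then show ?thesis
      by (simp add: A_def)
  qed
  \<comment> \<open>Here the term j = 0 drops out. After the shift of \<open>j\<close>, the powers
    q^(t-j) and q^j, the latter from \<open>choose2_Suc\<close>, combine to q^t.\<close>
  also have "(\<Sum>j\<le>Suc t. B j) = (\<Sum>j\<le>t. - x * q ^ t * (weight t j * x ^ j))"
  proof -
    have "B (Suc j) = - x * q ^ t * (weight t j * x ^ j)" if "j \<le> t" for j
    proof -
      have "q_prod q 0 (Suc j) = q_prod q 0 j * (1 - q ^ Suc j)"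
        by (simp add: q_prod_Suc power_int_add q_nonzero)
      moreover have "1 - q ^ Suc j \<noteq> 0"
        using power_neq_1[of "Suc j"] by simp
      moreover have "q powi choose2 (int (Suc j)) = q powi choose2 (int j) * q ^ j"
        by (simp only: choose2_Suc powi_add power_int_of_nat)
      moreover have "q ^ t = q ^ (t - j) * q ^ j"
        using that by (simp flip: power_add)
      ultimately show ?thesis
        by (simp add: B_def weight_def del: of_nat_Suc power_Suc) simp
    qed
    then show ?thesis
      by (subst sum.atMost_Suc_shift) (simp add: B_def)
  qed
  also have "(\<Sum>j\<le>t. weight t j * x ^ j) + \<dots> =
      (1 - x * q ^ t) * (\<Sum>j\<le>t. weight t j * x ^ j)"
    unfolding sum_distrib_left[symmetric] by (simp add: algebra_simps)
  finally show ?thesis .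
qed

text \<open>In the step of the recursion, either s = t and the new factor 1 - q^(t-s) is 0, or s < t
  and the previous sum is 0.\<close>

lemma sum_weight_eq_0: "s < t \<Longrightarrow> (\<Sum>j\<le>t. weight t j * (q powi (- int s)) ^ j) = 0"
proof (induction t)
  case (Suc t)
  have "(1 - q powi (- int s) * q ^ t) * (\<Sum>j\<le>t. weight t j * (q powi (- int s)) ^ j) = 0"
    using Suc by (cases "s = t") (auto simp: power_int_minus q_nonzero)
  then show ?case
    using sum_weight_Suc[of t "q powi (- int s)"] power_neq_1[of "Suc t"] by auto
qed simp

text \<open>As a polynomial in q^(-j), the product has degree \<open>r\<close>. Its last factor is
  linear in q^(-j), so peeling it off yields the same sum with \<open>s\<close> and with s + 1;
  carrying the extra power \<open>s\<close> makes the induction close.\<close>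

lemma sum_weight_q_prod_aux:
  "s + r < t \<Longrightarrow>
    (\<Sum>j\<le>t. weight t j * (q powi (- int s)) ^ j * q_prod q (a - int j) r) = 0"
proof (induction r arbitrary: s)
  case 0
  then show ?case by (simp add: sum_weight_eq_0)
next
  case (Suc r)
  let ?S = "\<lambda>s. \<Sum>j\<le>t. weight t j * (q powi (- int s)) ^ j * q_prod q (a - int j) r"
  have "weight t j * (q powi (- int s)) ^ j * q_prod q (a - int j) (Suc r) =
      weight t j * (q powi (- int s)) ^ j * q_prod q (a - int j) r -
      q powi (a + int r + 1) *
        (weight t j * (q powi (- int (Suc s))) ^ j * q_prod q (a - int j) r)" for j
  proof -
    have "q powi (a - int j + int r + 1) = q powi (a + int r + 1) * (q powi (-1)) ^ j"
      unfolding power_int_of_nat[symmetric] power_int_mult[symmetric] powi_add[symmetric]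
      by (simp add: algebra_simps)
    moreover have "(q powi (- int (Suc s))) ^ j = (q powi (- int s)) ^ j * (q powi (-1)) ^ j"
      unfolding power_mult_distrib[symmetric] powi_add[symmetric] by (simp add: algebra_simps)
    ultimately show ?thesis
      by (simp only: q_prod_Suc) (simp add: algebra_simps)
  qed
  then have "(\<Sum>j\<le>t. weight t j * (q powi (- int s)) ^ j * q_prod q (a - int j) (Suc r)) =
      ?S s - q powi (a + int r + 1) * ?S (Suc s)"
    by (simp only: sum_subtractf sum_distrib_left)
  then show ?case
    using Suc.IH[of s] Suc.IH[of "Suc s"] Suc.prems by simp
qed

lemma sum_weight_q_prod: "r < t \<Longrightarrow> (\<Sum>j\<le>t. weight t j * q_prod q (a - int j) r) = 0"
  using sum_weight_q_prod_aux[of 0 r t a] by simp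

section \<open>Normal form of the summands in a row\<close>

lemma A_summand:
  assumes "j \<le> Suc i" "Suc i < m"
  shows "q powi choose2 (int i - int j) * q_binomial q (int i + int j - int m) (int i - int j + 1) *
      (q powi v_exponent 5 m j * (q_bracket q (int m) / q_bracket q (int m - int j)) *
        q_binomial q (int m - int j) (int j)) =
    (-1) ^ Suc i * (1 - q powi int m) *
      q powi (choose2 (int i) + choose2 (int i + 1) - (int i + 1) * int m + v_exponent 5 m 0) *
      (weight (Suc i) j * q_prod q (int m - int (Suc i) - int j) i)"
proof -
  define r where "r = Suc i - j"
  define b where "b = int m - int (Suc i) - int j"
  have r: "int i - int j + 1 = int r" "Suc i = r + j" "int i + 1 - int j = int r" and i: "int i = int r + int j - 1"
    using assms by (auto simp: r_def)
  have b: "int m - 2 * int j - int r = b" "b + int r = int m - 2 * int j"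
    using assms by (auto simp: r_def b_def)
  have left: "q_binomial q (int i + int j - int m) (int i - int j + 1) =
      (-1) ^ r * q powi (choose2 (int r) - int r * (int m - 2 * int j)) * q_prod q b r /
        q_prod q 0 r"
    using q_prod_reflect[of "int m - 2 * int j" r]
    by (simp add: r(1) q_binomial_eq_q_prod b) (simp add: i algebra_simps)
  have quot: "q_bracket q (int m) / q_bracket q (int m - int j) =
      (1 - q powi int m) / (1 - q powi (int m - int j))"
    by (simp add: q_bracket_def)
  \<comment> \<open>The reflected matrix entry supplies the exponents b + 1, ..., m - 2j and the
    vector entry supplies m - 2j + 1, ..., m - j. Together they form one run of i + 1 factors, whose
    last is cancelled by [m - j]. This leaves degree \<open>i\<close> in q^(-j), below t = i +
    1.\<close>
  have merge: "q_prod q b r * q_prod q (int m - 2 * int j) j =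
      q_prod q b i * (1 - q powi (int m - int j))"
  proof -
    have "q_prod q b r * q_prod q (int m - 2 * int j) j = q_prod q b (Suc i)"
      by (simp add: r(2) q_prod_add b(2))
    then show ?thesis
      by (simp add: q_prod_Suc b_def)
  qed
  \<comment> \<open>From j <= i + 1 < m, the exponent m - j is positive.\<close>
  have nz: "1 - q powi (int m - int j) \<noteq> 0"
    using powi_neq_1[of "int m - int j"] assms by auto
  have right: "q_prod q b r * (q_bracket q (int m) / q_bracket q (int m - int j) *
      q_binomial q (int m - int j) (int j)) = (1 - q powi int m) * q_prod q b i / q_prod q 0 j"
  proof -
    have "q_prod q b r * (q_bracket q (int m) / q_bracket q (int m - int j) *
        q_binomial q (int m - int j) (int j)) =
        (1 - q powi int m) * (q_prod q b r * q_prod q (int m - 2 * int j) j) /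
          ((1 - q powi (int m - int j)) * q_prod q 0 j)"
      unfolding quot q_binomial_eq_q_prod by simp
    also have "\<dots> = (1 - q powi int m) * q_prod q b i / q_prod q 0 j"
      unfolding merge using nz by simp
    finally show ?thesis .
  qed
  have "q powi choose2 (int i - int j) *
      q powi (choose2 (int r) - int r * (int m - 2 * int j)) * q powi v_exponent 5 m j =
      q powi choose2 (int j) *
      q powi (choose2 (int i) + choose2 (int i + 1) - (int i + 1) * int m + v_exponent 5 m 0)"
    by (simp only: A_exponent[of i j m, unfolded r(3)] powi_add[symmetric])
  moreover have "(-1 :: 'a) ^ r = (-1) ^ Suc i * (-1) ^ j"
    by (simp add: r(2) power_add)
  ultimately have *: "(-1) ^ r * (q powi choose2 (int i - int j) *
      q powi (choose2 (int r) - int r * (int m - 2 * int j)) * q powi v_exponent 5 m j) =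
      (-1) ^ Suc i * (-1) ^ j * (q powi choose2 (int j) *
      q powi (choose2 (int i) + choose2 (int i + 1) - (int i + 1) * int m + v_exponent 5 m 0))"
    by (simp only:)
  have "q powi choose2 (int i - int j) * q_binomial q (int i + int j - int m) (int i - int j + 1) *
      (q powi v_exponent 5 m j * (q_bracket q (int m) / q_bracket q (int m - int j)) *
        q_binomial q (int m - int j) (int j)) =
      (-1) ^ r * (q powi choose2 (int i - int j) *
        q powi (choose2 (int r) - int r * (int m - 2 * int j)) * q powi v_exponent 5 m j) *
      (q_prod q b r * (q_bracket q (int m) / q_bracket q (int m - int j) *
        q_binomial q (int m - int j) (int j))) / q_prod q 0 r"
    unfolding left
    by (simp only: mult_ac times_divide_eq_left times_divide_eq_right divide_divide_eq_left)
  also have "\<dots> = (-1) ^ Suc i * (1 - q powi int m) *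
      q powi (choose2 (int i) + choose2 (int i + 1) - (int i + 1) * int m + v_exponent 5 m 0) *
      (weight (Suc i) j * q_prod q b i)"
    unfolding * right weight_def r_def[symmetric]
    by (simp only: mult_ac times_divide_eq_left times_divide_eq_right divide_divide_eq_left)
  finally show ?thesis
    unfolding b_def .
qed

text \<open>Now the two runs of exponents join to exactly \<open>i\<close> factors, and the
  denominator [i - j + 1] extends \<open>q_prod q 0 (i - j)\<close> to the
  \<open>q_prod q 0 (Suc i - j)\<close> of \<open>weight\<close>. The factor [2i + 1 - m] is
  constant along the row. The superdiagonal entry, 1 by convention, is treated separately.\<close>

lemma B_summand:
  assumes "j \<le> Suc i"
  shows "q powi choose2 (int i - int j) * B_factor (int i) (int j) (- int m) q *
      (q powi v_exponent 3 m j * q_binomial q (int m - int j) (int j)) =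
    (-1) ^ i * (1 - q powi (2 * int i + 1 - int m)) *
      q powi (2 * choose2 (int i) - int i * int m + v_exponent 3 m 0) *
      (weight (Suc i) j * q_prod q (int m - int i - int j) i)"
proof (cases "j = Suc i")
  case True
  \<comment> \<open>On the superdiagonal the row constant must come from the vector entry: its first
    factor 1 - q^(m-2i-1) reflects to it.\<close>
  have "q_prod q (int m - 2 * int j) j =
      (1 - q powi (int m - 2 * int i - 1)) * q_prod q (int m - int i - int j) i"
    by (simp add: True q_prod_Suc_left algebra_simps)
  moreover have "1 - q powi (int m - 2 * int i - 1) =
      - (q powi (int m - 2 * int i - 1)) * (1 - q powi (2 * int i + 1 - int m))"
    using q_nonzero by (simp add: algebra_simps flip: power_int_add)
  ultimately have right: "q_binomial q (int m - int j) (int j) =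
      - (q powi (int m - 2 * int i - 1)) * (1 - q powi (2 * int i + 1 - int m)) *
      q_prod q (int m - int i - int j) i / q_prod q 0 j"
    by (simp only: q_binomial_eq_q_prod) simp
  \<comment> \<open>At i - j = -1 the reflection exponent in \<open>B_exponent\<close> is 1 + (m -
    2j) = m - 2i - 1, the power just extracted.\<close>
  have c: "choose2 (- 1) = 1"
    by (simp add: choose2_def)
  have powers: "q powi choose2 (int i - int j) * q powi v_exponent 3 m j *
      q powi (int m - 2 * int i - 1) =
      q powi choose2 (int j) * q powi (2 * choose2 (int i) - int i * int m + v_exponent 3 m 0)"
    using B_exponent[of i j m]
    unfolding powi_add[symmetric]
    by (intro arg_cong[of _ _ "(powi) q"]) (simp add: True c algebra_simps)
  have sign: "(-1 :: 'a) ^ i * (-1) ^ j = -1"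
    by (simp add: True flip: power_add mult_2)
  have "B_factor (int i) (int j) (- int m) q = 1"
    by (simp add: B_factor_def True)
  then have "q powi choose2 (int i - int j) * B_factor (int i) (int j) (- int m) q *
      (q powi v_exponent 3 m j * q_binomial q (int m - int j) (int j)) =
      - (q powi choose2 (int i - int j) * q powi v_exponent 3 m j *
        q powi (int m - 2 * int i - 1)) * (1 - q powi (2 * int i + 1 - int m)) *
        q_prod q (int m - int i - int j) i / q_prod q 0 j"
    unfolding right by simp
  also have "\<dots> = ((-1) ^ i * (-1) ^ j) * (q powi choose2 (int j) *
      q powi (2 * choose2 (int i) - int i * int m + v_exponent 3 m 0)) *
      (1 - q powi (2 * int i + 1 - int m)) * q_prod q (int m - int i - int j) i / q_prod q 0 j"
    unfolding powers sign by simp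
  finally show ?thesis
    by (simp only: weight_def True diff_self_eq_0 q_prod_0 mult_1_right)
      (simp only: mult_ac times_divide_eq_left times_divide_eq_right)
next
  case False
  define r where "r = i - j"
  define b where "b = int m - int i - int j"
  have r: "int i - int j = int r" "i = r + j" and i: "int i = int r + int j" and le: "j \<le> i"
    using assms False by (auto simp: r_def)
  have b: "int m - 2 * int j - int r = b" "b + int r = int m - 2 * int j"
    using i by (auto simp: b_def)
  have S: "q_prod q 0 (Suc i - j) = q_prod q 0 r * (1 - q powi (int r + 1))"
    using le by (simp add: Suc_diff_le r_def q_prod_Suc)
  have nz: "1 - q powi (int r + 1) \<noteq> 0"
    using powi_neq_1[of "int r + 1"] by auto
  have left: "B_factor (int i) (int j) (- int m) q =
      (1 - q powi (2 * int i + 1 - int m)) *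
      ((-1) ^ r * q powi (choose2 (int r) - int r * (int m - 2 * int j)) * q_prod q b r) /
        q_prod q 0 (Suc i - j)"
    using q_prod_reflect[of "int m - 2 * int j" r] le
    by (simp add: B_factor_def r(1) q_binomial_eq_q_prod b S q_bracket_def)
      (simp add: i algebra_simps)
  have right: "q_prod q b r * q_binomial q (int m - int j) (int j) = q_prod q b i / q_prod q 0 j"
    by (simp add: q_binomial_eq_q_prod r(2) q_prod_add b(2))
  have "q powi choose2 (int i - int j) *
      q powi (choose2 (int r) - int r * (int m - 2 * int j)) * q powi v_exponent 3 m j =
      q powi choose2 (int j) *
      q powi (2 * choose2 (int i) - int i * int m + v_exponent 3 m 0)"
    by (simp only: r(1) B_exponent[of i j m, unfolded r(1)] powi_add[symmetric])
  moreover have "(-1 :: 'a) ^ r = (-1) ^ i * (-1) ^ j"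
    by (simp add: r(2) power_add)
  ultimately have *: "(-1) ^ r * (q powi choose2 (int i - int j) *
      q powi (choose2 (int r) - int r * (int m - 2 * int j)) * q powi v_exponent 3 m j) =
      (-1) ^ i * (-1) ^ j * (q powi choose2 (int j) *
      q powi (2 * choose2 (int i) - int i * int m + v_exponent 3 m 0))"
    by (simp only:)
  have "q powi choose2 (int i - int j) * B_factor (int i) (int j) (- int m) q *
      (q powi v_exponent 3 m j * q_binomial q (int m - int j) (int j)) =
      (1 - q powi (2 * int i + 1 - int m)) * ((-1) ^ r * (q powi choose2 (int i - int j) *
        q powi (choose2 (int r) - int r * (int m - 2 * int j)) * q powi v_exponent 3 m j)) *
      (q_prod q b r * q_binomial q (int m - int j) (int j)) / q_prod q 0 (Suc i - j)"
    unfolding left by simp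
  also have "\<dots> = (-1) ^ i * (1 - q powi (2 * int i + 1 - int m)) *
      q powi (2 * choose2 (int i) - int i * int m + v_exponent 3 m 0) *
      (weight (Suc i) j * q_prod q b i)"
    unfolding * right weight_def by simp
  finally show ?thesis
    unfolding b_def .
qed

section \<open>The kernel vectors and the passage to an indeterminate\<close>

lemma A_mat_kernel:
  assumes "n > 0" "n + 1 \<le> m" "m \<le> 2 * n - 1"
  shows "A_mat n (- int m) q *\<^sub>v v_vec n m q = 0\<^sub>v n"
proof -
  let ?g = "\<lambda>i j. q powi choose2 (int i - int j) *
      q_binomial q (int i + int j - int m) (int i - int j + 1) *
      (q powi v_exponent 5 m j * (q_bracket q (int m) / q_bracket q (int m - int j)) *
        q_binomial q (int m - int j) (int j))"
  show ?thesis
  proof (rule mult_mat_vec_eq_0I[where g = ?g])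
    show "A_mat n (- int m) q $$ (i, j) * v_vec n m q $ j = ?g i j" if "i < n" "j < n" for i j
      using that by (simp add: v_vec_index A_mat_def Let_def)
    show "?g i j = 0" if "Suc i < j" for i j
      using that by (simp add: q_binomial_def)
    show "?g i n = 0" for i
      using assms by (simp add: q_binomial_last_eq_0)
    show "(\<Sum>j\<le>Suc i. ?g i j) = 0" if "i < n" for i
    proof -
      have "(\<Sum>j\<le>Suc i. ?g i j) = (-1) ^ Suc i * (1 - q powi int m) *
        q powi (choose2 (int i) + choose2 (int i + 1) - (int i + 1) * int m + v_exponent 5 m 0) *
        (\<Sum>j\<le>Suc i. weight (Suc i) j * q_prod q (int m - int (Suc i) - int j) i)"
        \<comment> \<open>The condition \<open>Suc i < m\<close> of \<open>A_summand\<close> follows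
          from i < n and n + 1 <= m.\<close>
        unfolding sum_distrib_left using that assms by (intro sum.cong A_summand refl) auto
      then show ?thesis
        by (simp only: sum_weight_q_prod lessI mult_zero_right)
    qed
  qed (simp_all add: A_mat_def v_vec_def)
qed

lemma B_mat_kernel:
  assumes "n > 0" "n \<le> m" "m \<le> 2 * n - 1"
  shows "B_mat n (- int m) q *\<^sub>v u_vec n m q = 0\<^sub>v n"
proof -
  let ?g = "\<lambda>i j. q powi choose2 (int i - int j) * B_factor (int i) (int j) (- int m) q *
      (q powi v_exponent 3 m j * q_binomial q (int m - int j) (int j))"
  show ?thesis
  proof (rule mult_mat_vec_eq_0I[where g = ?g])
    show "B_mat n (- int m) q $$ (i, j) * u_vec n m q $ j = ?g i j" if "i < n" "j < n" for i j
      using that by (simp add: u_vec_index B_mat_def Let_def)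
    show "?g i j = 0" if "Suc i < j" for i j
      using that by (simp add: B_factor_def)
    show "?g i n = 0" for i
      using assms by (simp add: q_binomial_last_eq_0)
    show "(\<Sum>j\<le>Suc i. ?g i j) = 0" for i
    proof -
      have "(\<Sum>j\<le>Suc i. ?g i j) = (-1) ^ i * (1 - q powi (2 * int i + 1 - int m)) *
        q powi (2 * choose2 (int i) - int i * int m + v_exponent 3 m 0) *
        (\<Sum>j\<le>Suc i. weight (Suc i) j * q_prod q (int m - int i - int j) i)"
        unfolding sum_distrib_left by (intro sum.cong B_summand refl) auto
      then show ?thesis
        by (simp only: sum_weight_q_prod lessI mult_zero_right)
    qed
  qed (simp_all add: B_mat_def u_vec_def)
qed

end

text \<open>The \<open>n\<close>-th power of the variable has degree \<open>n\<close>, hence is not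
  1 for n > 0, and polynomials embed injectively into their fraction field.\<close>

lemma non_root_of_unity_q_indet: "non_root_of_unity (q_indet :: 'k::field poly fract)"
proof
  show "(q_indet :: 'k poly fract) \<noteq> 0"
    by (simp add: q_indet_def Zero_fract_def eq_fract)
  fix n :: nat
  assume "n > 0"
  have "(q_indet :: 'k poly fract) ^ n = Fract ([:0, 1:] ^ n) 1"
    by (induction n) (simp_all add: q_indet_def One_fract_def)
  moreover have "degree ([:0, 1 :: 'k:] ^ n) = n"
    by (simp add: degree_power_eq)
  then have "[:0, 1 :: 'k:] ^ n \<noteq> 1"
    using \<open>n > 0\<close> by auto
  ultimately show "(q_indet :: 'k poly fract) ^ n \<noteq> 1"
    by (simp add: One_fract_def eq_fract)
qed

theorem theorem15:
  fixes q :: "'k::field poly fract" and n m :: nat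
  assumes "q = q_indet" and "n > 0" and "m > 0"
  shows "(n + 1 \<le> m \<and> m \<le> 2 * n - 1 \<longrightarrow> A_mat n (- int m) q *\<^sub>v v_vec n m q = 0\<^sub>v n) \<and>
         (n \<le> m \<and> m \<le> 2 * n - 1 \<longrightarrow> B_mat n (- int m) q *\<^sub>v u_vec n m q = 0\<^sub>v n)"
  using non_root_of_unity.A_mat_kernel non_root_of_unity.B_mat_kernel
    non_root_of_unity_q_indet assms by blast

end
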